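(* A forest category $\mathcal C$ is globally idempotent and commutative if and only if the following holds: whenever $D_1$ and $D_2$ are forest diagrams over $\mathcal C$ with $\mathrm{supp}(D_1)=\mathrm{supp}(D_2)$ and $\mathrm{rootsum}(D_1)=\mathrm{rootsum}(D_2)$, we have $\mathrm{val}(D_1)=\mathrm{val}(D_2)$.
   Context: Forest algebras. A forest algebra $(H,V)$ consists of a commutative monoid $H$ (additive, identity $0$), a monoid $V$, and a faithful right action $H\times V\to H$ such that for $v\in V$, $h\in H$ there is $v+h\in V$ with $g(v+h)=gv+h$ for all $g\in H$. If $H$ is an idempotent commutative monoid, then $H$ acting on itself by $hv=h+v$ gives a forest algebra $(H,H)$, called a flat idempotent and commutative forest algebra. Forest categories. A forest category $\mathcal C$ consists of: a finite set $\mathrm{Obj}(\mathcal C)$ which is a commutative monoid under $+$ with identity $0$; for all objects $x,y$ a set $\mathrm{Arr}(x,y)$ of arrows (pairwise disjoint, union $\mathrm{Arr}(\mathcal C)$); for each object $x$ a set $\mathrm{HArr}(x)$ of half-arrows to $x$ (pairwise disjoint, union $\mathrm{HArr}(\mathcal C)$), subject to: (1) $\mathrm{HArr}(\mathcal C)$ is a commutative monoid under $+$ with $\mathrm{HArr}(x)+\mathrm{HArr}(y)\subseteq\mathrm{HArr}(x+y)$, the end map being a homomorphism onto $\mathrm{Obj}(\mathcal C)$; (2) an associative composition $\mathrm{Arr}(x,y)\times\mathrm{Arr}(y,z)\to\mathrm{Arr}(x,z)$ with identity arrows $1_x$; (3) an action $\mathrm{HArr}(x)\times\mathrm{Arr}(x,y)\to\mathrm{HArr}(y)$,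 $(c,u)\mapsto cu$, with $(cu)v=c(uv)$, $c1_x=c$, faithful (if $cu=cu'$ for all $c\in\mathrm{HArr}(x)$ then $u=u'$); (4) for $u\in\mathrm{Arr}(x,y)$, $c\in\mathrm{HArr}(z)$ an arrow $u+c\in\mathrm{Arr}(x,y+z)$ with $f(u+c)=(fu)+c$ for all $f\in\mathrm{Arr}(w,x)$ and $(u+c)+d=u+(c+d)$. Division. $\mathcal C\prec(H,V)$ means: there are nonempty sets $K_c\subseteq H$ for each half-arrow $c$ and $K_u\subseteq V$ for each arrow $u$ with $K_uK_v\subseteq K_{uv}$, $K_cK_u\subseteq K_{cu}$, $K_c+K_d\subseteq K_{c+d}$, $K_u+K_c\subseteq K_{u+c}$ whenever defined, and distinct arrows in the same $\mathrm{Arr}(x,y)$ (resp. distinct half-arrows in the same $\mathrm{HArr}(y)$) have disjoint covering sets. $\mathcal C$ is globally idempotent and commutative if it divides some flat idempotent and commutative forest algebra. Forest diagrams. A forest diagram over $\mathcal C$ is a finite forest (unordered children) whose leaves are labeled by half-arrows and internal nodes by arrows, such that each internal node's label lies in $\mathrm{Arr}(x,y)$ with $x$ the sum of the end objects of its children's labels (the end object of a half-arrow in $\mathrm{HArr}(x)$ is $x$; of an arrow in $\mathrm{Arr}(x,y)$ is $y$). $\mathrm{rootsum}(D)$ is the sum of the end objects of the root labels. $\mathrm{val}(D)\in\mathrm{HArr}(\mathrm{rootsum}(D))$ is computed bottom-up: a leaf has value its label, an internal node labeled $u$ whose children have values $c_1,\dots,c_m$ has value $(c_1+\dots+c_m)u$,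 and $\mathrm{val}(D)$ is the sum of the values of the roots. $\mathrm{supp}(D)$ is the set of arrows and half-arrows occurring as labels in $D$.
   Formalization: The law f(u+c)=(fu)+c in axiom (4) is also required for half-arrows f in HArr(x), not only for arrows f; without this the equivalence fails (one object, half-arrows {0,1} under "or", a single arrow 1 with 1+c=1). *)

theory Defs
  imports "HOL-Algebra.FiniteProduct" "HOL-Library.Multiset"
begin

text \<open>
  Commutative monoids are monoids of \<open>HOL-Algebra\<close>, hence written
  multiplicatively here although the mathematics writes them additively: for the monoids
  \<open>Obj C\<close>, \<open>Half C\<close> and \<open>Hor A\<close> below, \<open>\<otimes>\<close> is the addition and
  \<open>\<one>\<close> is the identity 0.
\<close>

section \<open>Forest algebras\<close>

text \<open>\<open>actA A g v\<close> is \<open>g v\<close>, and \<open>insA A v h\<close> is \<open>v + h\<close>.\<close>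

record ('m, 'v) forest_alg =
  Hor :: "'m monoid"
  Ver :: "'v monoid"
  actA :: "'m \<Rightarrow> 'v \<Rightarrow> 'm"
  insA :: "'v \<Rightarrow> 'm \<Rightarrow> 'v"

locale forest_algebra =
  fixes A :: "('m, 'v) forest_alg"
  assumes Hor_comm_monoid: "comm_monoid (Hor A)"
    and Ver_monoid: "monoid (Ver A)"
    and actA_closed: "\<lbrakk>g \<in> carrier (Hor A); v \<in> carrier (Ver A)\<rbrakk> \<Longrightarrow> actA A g v \<in> carrier (Hor A)"
    and actA_one: "g \<in> carrier (Hor A) \<Longrightarrow> actA A g \<one>\<^bsub>Ver A\<^esub> = g"
    and actA_mult: "\<lbrakk>g \<in> carrier (Hor A); v \<in> carrier (Ver A); w \<in> carrier (Ver A)\<rbrakk>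
      \<Longrightarrow> actA A (actA A g v) w = actA A g (v \<otimes>\<^bsub>Ver A\<^esub> w)"
    and actA_faithful: "\<lbrakk>v \<in> carrier (Ver A); w \<in> carrier (Ver A);
      \<And>g. g \<in> carrier (Hor A) \<Longrightarrow> actA A g v = actA A g w\<rbrakk> \<Longrightarrow> v = w"
    and insA_closed: "\<lbrakk>v \<in> carrier (Ver A); h \<in> carrier (Hor A)\<rbrakk> \<Longrightarrow> insA A v h \<in> carrier (Ver A)"
    and actA_insA: "\<lbrakk>g \<in> carrier (Hor A); v \<in> carrier (Ver A); h \<in> carrier (Hor A)\<rbrakk>
      \<Longrightarrow> actA A g (insA A v h) = actA A g v \<otimes>\<^bsub>Hor A\<^esub> h"

definition idem_comm_monoid :: "'m monoid \<Rightarrow> bool" where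
  "idem_comm_monoid H \<longleftrightarrow> comm_monoid H \<and> (\<forall>h\<in>carrier H. h \<otimes>\<^bsub>H\<^esub> h = h)"

definition flat_alg :: "'m monoid \<Rightarrow> ('m, 'm) forest_alg" where
  "flat_alg H = \<lparr>Hor = H, Ver = H, actA = (\<lambda>h v. h \<otimes>\<^bsub>H\<^esub> v), insA = (\<lambda>v h. v \<otimes>\<^bsub>H\<^esub> h)\<rparr>"

lemma forest_algebra_flat_alg:
  assumes "idem_comm_monoid H"
  shows "forest_algebra (flat_alg H)"
proof -
  interpret comm_monoid H
    using assms by (simp add: idem_comm_monoid_def)
  show ?thesis
  proof
    fix v w
    assume v: "v \<in> carrier (Ver (flat_alg H))" and w: "w \<in> carrier (Ver (flat_alg H))"
      and eq: "\<And>g. g \<in> carrier (Hor (flat_alg H)) \<Longrightarrow> actA (flat_alg H) g v = actA (flat_alg H) g w"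
    show "v = w"
      using eq[of "\<one>\<^bsub>H\<^esub>"] v w by (simp add: flat_alg_def)
  qed (simp_all add: flat_alg_def m_ac comm_monoid_axioms monoid_axioms)
qed

section \<open>Forest categories\<close>

text \<open>
  Pairwise disjoint families of arrows and half-arrows are given by their unions
  \<open>Arrows C\<close> and \<open>carrier (Half C)\<close> together with the end points of each arrow
  and the end of each half-arrow; \<open>Arr C x y\<close> and \<open>HArr C x\<close> recover the families.
  \<open>act C c u\<close> is \<open>c u\<close>, and \<open>ins C u c\<close> is \<open>u + c\<close>.
\<close>

record ('o, 'h, 'a) forest_cat =
  Obj :: "'o monoid"
  Half :: "'h monoid"
  Arrows :: "'a set"
  hend :: "'h \<Rightarrow> 'o"
  src :: "'a \<Rightarrow> 'o"
  tgt :: "'a \<Rightarrow> 'o"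
  arr_comp :: "'a \<Rightarrow> 'a \<Rightarrow> 'a"
  idn :: "'o \<Rightarrow> 'a"
  act :: "'h \<Rightarrow> 'a \<Rightarrow> 'h"
  ins :: "'a \<Rightarrow> 'h \<Rightarrow> 'a"

definition Arr :: "('o, 'h, 'a) forest_cat \<Rightarrow> 'o \<Rightarrow> 'o \<Rightarrow> 'a set" where
  "Arr C x y = {u \<in> Arrows C. src C u = x \<and> tgt C u = y}"

definition HArr :: "('o, 'h, 'a) forest_cat \<Rightarrow> 'o \<Rightarrow> 'h set" where
  "HArr C x = {c \<in> carrier (Half C). hend C c = x}"

text \<open>
  The axiom \<open>act_ins\<close> is the analogue of \<open>g (v + h) = g v + h\<close> for forest algebras.
  It implies \<open>comp_ins\<close>, by faithfulness, but does not follow from it. Without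
  \<open>act_ins\<close>, one object, the half-arrows \<open>False\<close>, \<open>True\<close> under disjunction and
  a single arrow \<open>1\<close> with \<open>1 + c = 1\<close> would form a forest category: there \<open>val\<close>
  depends only on the support, but no covering by an idempotent commutative \<open>H\<close> exists, as
  members \<open>p\<close>, \<open>q\<close>, \<open>i\<close> of the sets covering \<open>False\<close>,
  \<open>True\<close> and \<open>1\<close> would put \<open>p + i + q\<close> into both of the first two sets.
\<close>

locale forest_category =
  fixes C :: "('o, 'h, 'a) forest_cat"
  assumes Obj_comm_monoid: "comm_monoid (Obj C)"
    and Obj_finite: "finite (carrier (Obj C))"
    and src_closed: "u \<in> Arrows C \<Longrightarrow> src C u \<in> carrier (Obj C)"
    and tgt_closed: "u \<in> Arrows C \<Longrightarrow> tgt C u \<in> carrier (Obj C)"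
    and Half_comm_monoid: "comm_monoid (Half C)"
    and hend_epi: "hend C \<in> epi (Half C) (Obj C)"
    and comp_closed: "\<lbrakk>u \<in> Arr C x y; v \<in> Arr C y z\<rbrakk> \<Longrightarrow> arr_comp C u v \<in> Arr C x z"
    and comp_assoc: "\<lbrakk>u \<in> Arr C w x; v \<in> Arr C x y; t \<in> Arr C y z\<rbrakk>
      \<Longrightarrow> arr_comp C (arr_comp C u v) t = arr_comp C u (arr_comp C v t)"
    and idn_closed: "x \<in> carrier (Obj C) \<Longrightarrow> idn C x \<in> Arr C x x"
    and idn_comp: "u \<in> Arr C x y \<Longrightarrow> arr_comp C (idn C x) u = u"
    and comp_idn: "u \<in> Arr C x y \<Longrightarrow> arr_comp C u (idn C y) = u"
    and act_closed: "\<lbrakk>c \<in> HArr C x; u \<in> Arr C x y\<rbrakk> \<Longrightarrow> act C c u \<in> HArr C y"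
    and act_comp: "\<lbrakk>c \<in> HArr C x; u \<in> Arr C x y; v \<in> Arr C y z\<rbrakk>
      \<Longrightarrow> act C (act C c u) v = act C c (arr_comp C u v)"
    and act_idn: "c \<in> HArr C x \<Longrightarrow> act C c (idn C x) = c"
    and act_faithful: "\<lbrakk>u \<in> Arr C x y; u' \<in> Arr C x y;
      \<And>c. c \<in> HArr C x \<Longrightarrow> act C c u = act C c u'\<rbrakk> \<Longrightarrow> u = u'"
    and ins_closed: "\<lbrakk>u \<in> Arr C x y; c \<in> HArr C z\<rbrakk> \<Longrightarrow> ins C u c \<in> Arr C x (y \<otimes>\<^bsub>Obj C\<^esub> z)"
    and comp_ins: "\<lbrakk>f \<in> Arr C w x; u \<in> Arr C x y; c \<in> HArr C z\<rbrakk>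
      \<Longrightarrow> arr_comp C f (ins C u c) = ins C (arr_comp C f u) c"
    and act_ins: "\<lbrakk>d \<in> HArr C x; u \<in> Arr C x y; c \<in> HArr C z\<rbrakk>
      \<Longrightarrow> act C d (ins C u c) = act C d u \<otimes>\<^bsub>Half C\<^esub> c"
    and ins_ins: "\<lbrakk>u \<in> Arr C x y; c \<in> HArr C z; d \<in> HArr C w\<rbrakk>
      \<Longrightarrow> ins C (ins C u c) d = ins C u (c \<otimes>\<^bsub>Half C\<^esub> d)"

section \<open>Division\<close>

definition divides :: "('o, 'h, 'a) forest_cat \<Rightarrow> ('m, 'v) forest_alg \<Rightarrow> bool" where
  "divides C A \<longleftrightarrow> (\<exists>(KH :: 'h \<Rightarrow> 'm set) (KA :: 'a \<Rightarrow> 'v set).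
     (\<forall>c\<in>carrier (Half C). KH c \<noteq> {} \<and> KH c \<subseteq> carrier (Hor A)) \<and>
     (\<forall>u\<in>Arrows C. KA u \<noteq> {} \<and> KA u \<subseteq> carrier (Ver A)) \<and>
     (\<forall>x y z. \<forall>u\<in>Arr C x y. \<forall>v\<in>Arr C y z. \<forall>k\<in>KA u. \<forall>l\<in>KA v. k \<otimes>\<^bsub>Ver A\<^esub> l \<in> KA (arr_comp C u v)) \<and>
     (\<forall>x y. \<forall>c\<in>HArr C x. \<forall>u\<in>Arr C x y. \<forall>k\<in>KH c. \<forall>l\<in>KA u. actA A k l \<in> KH (act C c u)) \<and>
     (\<forall>c\<in>carrier (Half C). \<forall>d\<in>carrier (Half C). \<forall>k\<in>KH c. \<forall>l\<in>KH d.
        k \<otimes>\<^bsub>Hor A\<^esub> l \<in> KH (c \<otimes>\<^bsub>Half C\<^esub> d)) \<and>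
     (\<forall>u\<in>Arrows C. \<forall>c\<in>carrier (Half C). \<forall>k\<in>KA u. \<forall>l\<in>KH c. insA A k l \<in> KA (ins C u c)) \<and>
     (\<forall>x y. \<forall>u\<in>Arr C x y. \<forall>u'\<in>Arr C x y. u \<noteq> u' \<longrightarrow> KA u \<inter> KA u' = {}) \<and>
     (\<forall>y. \<forall>c\<in>HArr C y. \<forall>c'\<in>HArr C y. c \<noteq> c' \<longrightarrow> KH c \<inter> KH c' = {}))"

text \<open>
  HOL cannot quantify over types inside a formula, so the elements of \<open>H\<close> are
  taken from the type \<open>('h + 'a) set\<close>. This is no restriction: see
  \<open>globally_idem_commI\<close> below.
\<close>

definition globally_idem_comm :: "('o, 'h, 'a) forest_cat \<Rightarrow> bool" where
  "globally_idem_comm C \<longleftrightarrow>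
     (\<exists>H :: ('h + 'a) set monoid. idem_comm_monoid H \<and> divides C (flat_alg H))"

lemma finprod_Un_idem:
  assumes "idem_comm_monoid H" "finite S" "finite T" "f \<in> S \<union> T \<rightarrow> carrier H"
  shows "finprod H f (S \<union> T) = finprod H f S \<otimes>\<^bsub>H\<^esub> finprod H f T"
proof -
  interpret comm_monoid H
    using assms(1) by (simp add: idem_comm_monoid_def)
  have idem: "h \<otimes>\<^bsub>H\<^esub> h = h" if "h \<in> carrier H" for h
    using assms(1) that by (simp add: idem_comm_monoid_def)
  have f: "f \<in> S \<rightarrow> carrier H" "f \<in> T \<rightarrow> carrier H"
    "f \<in> S - T \<rightarrow> carrier H" "f \<in> S \<inter> T \<rightarrow> carrier H" "f \<in> T - S \<rightarrow> carrier H"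
    using assms(4) by auto
  define p where "p = finprod H f (S - T)"
  define q where "q = finprod H f (S \<inter> T)"
  define r where "r = finprod H f (T - S)"
  have c: "p \<in> carrier H" "q \<in> carrier H" "r \<in> carrier H"
    unfolding p_def q_def r_def using f by (auto intro!: finprod_closed)
  have S: "finprod H f S = p \<otimes>\<^bsub>H\<^esub> q"
    unfolding p_def q_def using finprod_Un_disjoint[of "S - T" "S \<inter> T" f] assms(2,3) f
    by (simp add: Int_Diff_disjoint Un_Diff_Int Diff_Int_distrib2)
  have T: "finprod H f T = q \<otimes>\<^bsub>H\<^esub> r"
  proof -
    have "finprod H f ((S \<inter> T) \<union> (T - S)) = q \<otimes>\<^bsub>H\<^esub> r"
      unfolding q_def r_def using assms(2,3) f by (intro finprod_Un_disjoint) auto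
    moreover have "(S \<inter> T) \<union> (T - S) = T" by auto
    ultimately show ?thesis by simp
  qed
  have U: "finprod H f (S \<union> T) = (p \<otimes>\<^bsub>H\<^esub> q) \<otimes>\<^bsub>H\<^esub> r"
  proof -
    have "finprod H f (S \<union> (T - S)) = finprod H f S \<otimes>\<^bsub>H\<^esub> r"
      unfolding r_def using assms(2,3) f by (intro finprod_Un_disjoint) auto
    then show ?thesis by (simp add: S)
  qed
  have "p \<otimes>\<^bsub>H\<^esub> q \<otimes>\<^bsub>H\<^esub> (q \<otimes>\<^bsub>H\<^esub> r) = p \<otimes>\<^bsub>H\<^esub> (q \<otimes>\<^bsub>H\<^esub> q) \<otimes>\<^bsub>H\<^esub> r"
    using c by (simp add: m_assoc)
  then show ?thesis
    using c by (simp add: S T U idem)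
qed

lemma globally_idem_commI:
  fixes C :: "('o, 'h, 'a) forest_cat" and H :: "'m monoid"
  assumes H: "idem_comm_monoid H" and div: "divides C (flat_alg H)"
  shows "globally_idem_comm C"
proof -
  interpret comm_monoid H
    using H by (simp add: idem_comm_monoid_def)
  obtain KH KA where
    KH': "\<forall>c\<in>carrier (Half C). KH c \<noteq> {} \<and> KH c \<subseteq> carrier H" and
    KA': "\<forall>u\<in>Arrows C. KA u \<noteq> {} \<and> KA u \<subseteq> carrier H" and
    rest: "\<forall>x y z. \<forall>u\<in>Arr C x y. \<forall>v\<in>Arr C y z. \<forall>k\<in>KA u. \<forall>l\<in>KA v. k \<otimes>\<^bsub>H\<^esub> l \<in> KA (arr_comp C u v)"
     "\<forall>x y. \<forall>c\<in>HArr C x. \<forall>u\<in>Arr C x y. \<forall>k\<in>KH c. \<forall>l\<in>KA u. k \<otimes>\<^bsub>H\<^esub> l \<in> KH (act C c u)"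
     "\<forall>c\<in>carrier (Half C). \<forall>d\<in>carrier (Half C). \<forall>k\<in>KH c. \<forall>l\<in>KH d.
        k \<otimes>\<^bsub>H\<^esub> l \<in> KH (c \<otimes>\<^bsub>Half C\<^esub> d)"
     "\<forall>u\<in>Arrows C. \<forall>c\<in>carrier (Half C). \<forall>k\<in>KA u. \<forall>l\<in>KH c. k \<otimes>\<^bsub>H\<^esub> l \<in> KA (ins C u c)"
     "\<forall>x y. \<forall>u\<in>Arr C x y. \<forall>u'\<in>Arr C x y. u \<noteq> u' \<longrightarrow> KA u \<inter> KA u' = {}"
     "\<forall>y. \<forall>c\<in>HArr C y. \<forall>c'\<in>HArr C y. c \<noteq> c' \<longrightarrow> KH c \<inter> KH c' = {}"
    using div unfolding divides_def flat_alg_def forest_alg.simps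
    by (elim exE conjE) (rule that; assumption)
  note KH = bspec[OF KH'] and KA = bspec[OF KA']
  define L :: "('h + 'a) set" where "L = Inl ` carrier (Half C) \<union> Inr ` Arrows C"
  define k where "k = case_sum (\<lambda>c. SOME h. h \<in> KH c) (\<lambda>u. SOME h. h \<in> KA u)"
  have kH: "k (Inl c) \<in> KH c" if "c \<in> carrier (Half C)" for c
    using KH[OF that] by (simp add: k_def some_in_eq)
  have kA: "k (Inr u) \<in> KA u" if "u \<in> Arrows C" for u
    using KA[OF that] by (simp add: k_def some_in_eq)
  have kL: "k \<in> S \<rightarrow> carrier H" if "S \<subseteq> L" for S
    using that kH kA KH KA unfolding L_def by blast
  define \<phi> where "\<phi> = finprod H k"
  have \<phi>Un: "\<phi> (S \<union> T) = \<phi> S \<otimes>\<^bsub>H\<^esub> \<phi> T" if "finite S" "S \<subseteq> L" "finite T" "T \<subseteq> L" for S T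
    unfolding \<phi>_def using that by (intro finprod_Un_idem H kL) auto
  have \<phi>1: "\<phi> {s} = k s" if "s \<in> L" for s
    unfolding \<phi>_def using kL[of "{s}"] that by (simp add: finprod_insert)
  define F :: "('h + 'a) set monoid" where
    "F = \<lparr>carrier = {S. finite S \<and> S \<subseteq> L}, monoid.mult = (\<union>), one = {}\<rparr>"
  have F: "idem_comm_monoid F"
    unfolding idem_comm_monoid_def F_def
    by (auto intro!: comm_monoidI)
  define MH where "MH c = {S. finite S \<and> S \<subseteq> L \<and> \<phi> S \<in> KH c}" for c
  define MA where "MA u = {S. finite S \<and> S \<subseteq> L \<and> \<phi> S \<in> KA u}" for u
  have neH: "{Inl c} \<in> MH c" if "c \<in> carrier (Half C)" for c
    using that kH[OF that] by (simp add: MH_def \<phi>1 L_def)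
  have neA: "{Inr u} \<in> MA u" if "u \<in> Arrows C" for u
    using that kA[OF that] by (simp add: MA_def \<phi>1 L_def)
  have "divides C (flat_alg F)"
    unfolding divides_def flat_alg_def
  proof (rule exI[of _ MH], rule exI[of _ MA], simp, intro conjI)
    show "\<forall>c\<in>carrier (Half C). MH c \<noteq> {} \<and> MH c \<subseteq> carrier F"
      using neH by (fastforce simp: MH_def F_def)
    show "\<forall>u\<in>Arrows C. MA u \<noteq> {} \<and> MA u \<subseteq> carrier F"
      using neA by (fastforce simp: MA_def F_def)
  qed (use rest in \<open>auto simp: MH_def MA_def F_def \<phi>Un disjoint_iff\<close>)
  with F show ?thesis
    unfolding globally_idem_comm_def by blast
qed

section \<open>Forest diagrams\<close>

datatype (hlabels: 'h, alabels: 'a) tree = Leaf 'h | Node 'a "('h, 'a) tree multiset"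

type_synonym ('h, 'a) forest = "('h, 'a) tree multiset"

text \<open>The sum of a multiset in a commutative monoid.\<close>

definition msum :: "'m monoid \<Rightarrow> 'm multiset \<Rightarrow> 'm" where
  "msum G M = finprod G (\<lambda>x. x [^]\<^bsub>G\<^esub> count M x) (set_mset M)"

lemma msum_empty: "comm_monoid G \<Longrightarrow> msum G {#} = \<one>\<^bsub>G\<^esub>"
  by (simp add: msum_def comm_monoid.finprod_empty)

lemma msum_add_mset:
  assumes "comm_monoid G" "x \<in> carrier G" "set_mset M \<subseteq> carrier G"
  shows "msum G (add_mset x M) = x \<otimes>\<^bsub>G\<^esub> msum G M"
proof -
  interpret comm_monoid G by fact
  define R where "R = set_mset M - {x}"
  have R: "finite R" "x \<notin> R" "R \<subseteq> carrier G"
    using assms(3) by (auto simp: R_def)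
  define p where "p = finprod G (\<lambda>y. y [^]\<^bsub>G\<^esub> count M y) R"
  have p: "p \<in> carrier G"
    unfolding p_def using R by (auto intro!: finprod_closed)
  have "msum G (add_mset x M) = finprod G (\<lambda>y. y [^]\<^bsub>G\<^esub> count (add_mset x M) y) (insert x R)"
    unfolding msum_def R_def by (simp add: insert_Diff_if)
  also have "\<dots> = x [^]\<^bsub>G\<^esub> Suc (count M x) \<otimes>\<^bsub>G\<^esub> finprod G (\<lambda>y. y [^]\<^bsub>G\<^esub> count (add_mset x M) y) R"
    using R assms(2) by (subst finprod_insert) auto
  also have "finprod G (\<lambda>y. y [^]\<^bsub>G\<^esub> count (add_mset x M) y) R = p"
    unfolding p_def using R by (intro finprod_cong') auto
  finally have 1: "msum G (add_mset x M) = x \<otimes>\<^bsub>G\<^esub> (x [^]\<^bsub>G\<^esub> count M x \<otimes>\<^bsub>G\<^esub> p)"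
    using assms(2) p by (simp add: m_ac del: nat_pow_Suc add: nat_pow_Suc2)
  have "msum G M = x [^]\<^bsub>G\<^esub> count M x \<otimes>\<^bsub>G\<^esub> p"
  proof (cases "x \<in># M")
    case True
    then have "set_mset M = insert x R" by (auto simp: R_def)
    then show ?thesis
      unfolding msum_def p_def using R assms(2) by (simp add: finprod_insert Pi_iff subset_iff)
  next
    case False
    then have "set_mset M = R" "count M x = 0" by (auto simp: R_def not_in_iff)
    then show ?thesis
      using p by (simp add: msum_def p_def)
  qed
  with 1 show ?thesis by simp
qed

primrec tree_end :: "('o, 'h, 'a) forest_cat \<Rightarrow> ('h, 'a) tree \<Rightarrow> 'o" where
  "tree_end C (Leaf c) = hend C c"
| "tree_end C (Node u M) = tgt C u"

definition rootsum :: "('o, 'h, 'a) forest_cat \<Rightarrow> ('h, 'a) forest \<Rightarrow> 'o" where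
  "rootsum C D = msum (Obj C) (image_mset (tree_end C) D)"

text \<open>Leaves carry half-arrows, so a node labeled by an arrow has at least one child.\<close>

inductive is_tree :: "('o, 'h, 'a) forest_cat \<Rightarrow> ('h, 'a) tree \<Rightarrow> bool" for C where
  Leaf: "c \<in> carrier (Half C) \<Longrightarrow> is_tree C (Leaf c)"
| Node: "\<lbrakk>M \<noteq> {#}; \<And>t. t \<in># M \<Longrightarrow> is_tree C t; u \<in> Arrows C; src C u = rootsum C M\<rbrakk>
    \<Longrightarrow> is_tree C (Node u M)"

definition is_forest_diagram :: "('o, 'h, 'a) forest_cat \<Rightarrow> ('h, 'a) forest \<Rightarrow> bool" where
  "is_forest_diagram C D \<longleftrightarrow> (\<forall>t\<in>#D. is_tree C t)"

primrec tree_val :: "('o, 'h, 'a) forest_cat \<Rightarrow> ('h, 'a) tree \<Rightarrow> 'h" where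
  "tree_val C (Leaf c) = c"
| "tree_val C (Node u M) = act C (msum (Half C) (image_mset (tree_val C) M)) u"

definition val :: "('o, 'h, 'a) forest_cat \<Rightarrow> ('h, 'a) forest \<Rightarrow> 'h" where
  "val C D = msum (Half C) (image_mset (tree_val C) D)"

definition supp :: "('h, 'a) forest \<Rightarrow> ('h + 'a) set" where
  "supp D = (\<Union>t\<in>set_mset D. Inl ` hlabels t \<union> Inr ` alabels t)"

end

(*
  If C divides a flat algebra (H, H), choose an element of the covering set of every label: the product
  of the chosen elements over the labels of D covers val D, and by idempotence it depends only on supp D.
  Conversely, let H consist of the finite sets of labels under union. A half-arrow c is covered by the
  supports of the nonempty diagrams with value c. An arrow u is covered by every S such that each nonempty
  diagram with value c can be turned into one with value c u by adding exactly the labels in S.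
  Faithfulness of the action on half-arrows separates the covers of parallel arrows.
*)
theory Submission
  imports Defs
begin

section \<open>Supports of diagrams and closure of diagrams under juxtaposition\<close>

lemma supp_empty [simp]: "supp {#} = {}"
  by (simp add: supp_def)

lemma supp_union [simp]: "supp (M + N) = supp M \<union> supp N"
  by (auto simp: supp_def)

lemma supp_add_mset: "supp (add_mset t M) = supp {#t#} \<union> supp M"
  by (auto simp: supp_def)

lemma supp_Leaf [simp]: "supp {#Leaf c#} = {Inl c}"
  by (auto simp: supp_def)

lemma supp_Node [simp]: "supp {#Node u M#} = insert (Inr u) (supp M)"
  by (auto simp: supp_def)

lemma finite_supp_singleton: "finite (supp {#t#})"
proof (induction t)
  case (Leaf c)
  show ?case by simp
next
  case (Node u M)
  have "finite (supp M)"
    using Node.IH by (auto simp: supp_def)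
  then show ?case by simp
qed

text \<open>Finiteness matters twice: \<open>finprod\<close> over an infinite set is the identity by
  convention, and the monoid built for the converse has only finite sets as elements.\<close>

lemma finite_supp: "finite (supp D)"
proof (induction D)
  case (add t D)
  then show ?case
    by (simp add: supp_add_mset[of t D] finite_supp_singleton)
qed simp

lemma is_forest_diagram_empty [simp]: "is_forest_diagram C {#}"
  by (simp add: is_forest_diagram_def)

lemma is_forest_diagram_add_mset [simp]:
  "is_forest_diagram C (add_mset t D) \<longleftrightarrow> is_tree C t \<and> is_forest_diagram C D"
  by (auto simp: is_forest_diagram_def)

lemma is_forest_diagram_union [simp]:
  "is_forest_diagram C (D + E) \<longleftrightarrow> is_forest_diagram C D \<and> is_forest_diagram C E"
  by (auto simp: is_forest_diagram_def)

lemma msum_singleton: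
  assumes "comm_monoid G" "x \<in> carrier G"
  shows "msum G {#x#} = x"
proof -
  interpret comm_monoid G by fact
  show ?thesis
    using assms by (simp add: msum_add_mset msum_empty)
qed

section \<open>Ends and values of diagrams\<close>

context forest_category
begin

sublocale Half: comm_monoid "Half C"
  by (rule Half_comm_monoid)

sublocale Obj: comm_monoid "Obj C"
  by (rule Obj_comm_monoid)

lemma hend_closed: "c \<in> carrier (Half C) \<Longrightarrow> hend C c \<in> carrier (Obj C)"
  using hend_epi by (auto simp: epi_def hom_def)

lemma hend_mult:
  "\<lbrakk>c \<in> carrier (Half C); d \<in> carrier (Half C)\<rbrakk>
    \<Longrightarrow> hend C (c \<otimes>\<^bsub>Half C\<^esub> d) = hend C c \<otimes>\<^bsub>Obj C\<^esub> hend C d"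
  using hend_epi by (auto simp: epi_def hom_def)

text \<open>Membership in \<open>epi\<close> gives only multiplicativity and surjectivity.
  Surjectivity yields the identity: if \<open>c\<close> is mapped to the identity, then multiplying
  \<open>c\<close> by the identity half-arrow and applying \<open>hend C\<close> leaves exactly the
  image of that identity.\<close>

lemma hend_one: "hend C \<one>\<^bsub>Half C\<^esub> = \<one>\<^bsub>Obj C\<^esub>"
proof -
  obtain c where c: "c \<in> carrier (Half C)" "hend C c = \<one>\<^bsub>Obj C\<^esub>"
    using hend_epi by (auto simp: epi_def) (metis Obj.one_closed imageE)
  then show ?thesis
    using hend_mult[of c "\<one>\<^bsub>Half C\<^esub>"] hend_closed[of "\<one>\<^bsub>Half C\<^esub>"] by simp
qed

lemma tree_val_HArr: "is_tree C t \<Longrightarrow> tree_val C t \<in> HArr C (tree_end C t)"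
  and val_HArr: "is_forest_diagram C D \<Longrightarrow> val C D \<in> HArr C (rootsum C D)"
proof -
  \<comment> \<open>The claim for forests assumes the claim only for the trees of \<open>D\<close>,
    so it can be applied to the children of a node inside the induction on trees.\<close>
  have forest: "val C D \<in> HArr C (rootsum C D)"
    if "\<And>t. t \<in># D \<Longrightarrow> tree_val C t \<in> HArr C (tree_end C t)" for D
    using that
  proof (induction D)
    case empty
    show ?case
      by (simp add: val_def rootsum_def msum_empty HArr_def hend_one
          Half_comm_monoid Obj_comm_monoid)
  next
    case (add t D)
    have cl: "tree_val C s \<in> carrier (Half C)" "hend C (tree_val C s) = tree_end C s"
      if "s \<in># add_mset t D" for s
      using add.prems[OF that] by (auto simp: HArr_def)
    then have cl': "tree_end C s \<in> carrier (Obj C)" if "s \<in># add_mset t D" for s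
      using hend_closed that by metis
    have "val C (add_mset t D) = tree_val C t \<otimes>\<^bsub>Half C\<^esub> val C D"
      unfolding val_def using cl by (auto intro!: msum_add_mset Half_comm_monoid)
    moreover have "rootsum C (add_mset t D) = tree_end C t \<otimes>\<^bsub>Obj C\<^esub> rootsum C D"
      unfolding rootsum_def using cl' by (auto intro!: msum_add_mset Obj_comm_monoid)
    ultimately show ?case
      using add.IH add.prems cl[of t] by (auto simp: HArr_def hend_mult)
  qed
  show tree: "tree_val C t \<in> HArr C (tree_end C t)" if "is_tree C t" for t
    using that
  proof induction
    case (Leaf c)
    then show ?case by (simp add: HArr_def)
  next
    case (Node M u)
    have "val C M \<in> HArr C (src C u)"
      using forest[of M] Node by simp
    then show ?case
      using act_closed[of "val C M" "src C u" u "tgt C u"] Node.hyps by (simp add: Arr_def val_def)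
  qed
  show "val C D \<in> HArr C (rootsum C D)" if "is_forest_diagram C D"
    using that tree by (intro forest) (auto simp: is_forest_diagram_def)
qed

lemma tree_val_closed: "is_tree C t \<Longrightarrow> tree_val C t \<in> carrier (Half C)"
  using tree_val_HArr by (auto simp: HArr_def)

lemma val_closed: "is_forest_diagram C D \<Longrightarrow> val C D \<in> carrier (Half C)"
  using val_HArr by (auto simp: HArr_def)

lemma hend_val: "is_forest_diagram C D \<Longrightarrow> hend C (val C D) = rootsum C D"
  using val_HArr by (auto simp: HArr_def)

lemma val_empty: "val C {#} = \<one>\<^bsub>Half C\<^esub>"
  by (simp add: val_def msum_empty Half_comm_monoid)

lemma val_singleton: "is_tree C t \<Longrightarrow> val C {#t#} = tree_val C t"
  by (simp add: val_def msum_singleton Half_comm_monoid tree_val_closed)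

lemma val_add_mset:
  assumes "is_tree C t" "is_forest_diagram C D"
  shows "val C (add_mset t D) = tree_val C t \<otimes>\<^bsub>Half C\<^esub> val C D"
  unfolding val_def using assms
  by (auto simp: is_forest_diagram_def intro!: msum_add_mset Half_comm_monoid tree_val_closed)

text \<open>Juxtaposing diagrams realises addition of half-arrows. This supplies the witnesses for
  the additive conditions of division in the converse.\<close>

lemma val_union:
  assumes "is_forest_diagram C D" "is_forest_diagram C E"
  shows "val C (D + E) = val C D \<otimes>\<^bsub>Half C\<^esub> val C E"
  using assms(1)
proof (induction D)
  case empty
  show ?case using assms(2) by (simp add: val_empty val_closed)
next
  case (add t D)
  then show ?case
    using assms(2) by (simp add: val_add_mset tree_val_closed val_closed Half.m_assoc)
qed

text \<open>Confines products over a support to labels whose covering sets are nonempty, where a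
  choice of covering element makes sense.\<close>

lemma supp_is_tree:
  assumes "is_tree C t"
  shows "supp {#t#} \<subseteq> Inl ` carrier (Half C) \<union> Inr ` Arrows C"
  using assms
proof induction
  case (Node M u)
  then have "supp M \<subseteq> Inl ` carrier (Half C) \<union> Inr ` Arrows C"
    by (simp add: supp_def UN_subset_iff)
  with Node.hyps show ?case by simp
qed simp

lemma supp_is_forest_diagram:
  assumes "is_forest_diagram C D"
  shows "supp D \<subseteq> Inl ` carrier (Half C) \<union> Inr ` Arrows C"
  using supp_is_tree assms unfolding is_forest_diagram_def supp_def by fastforce

section \<open>From a division to equality of values\<close>

text \<open>Equal supports give one common element of \<open>H\<close> in the covering sets of both
  values. Equal root sums make the values half-arrows with the same end, so disjointness of the
  covering sets identifies them.\<close>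

lemma val_eq_if_globally_idem_comm:
  assumes "globally_idem_comm C"
    and D: "is_forest_diagram C D1" "is_forest_diagram C D2"
    and supp: "supp D1 = supp D2" and roots: "rootsum C D1 = rootsum C D2"
  shows "val C D1 = val C D2"
proof -
  obtain H :: "('h + 'a) set monoid" where H: "idem_comm_monoid H" and div: "divides C (flat_alg H)"
    using assms(1) by (auto simp: globally_idem_comm_def)
  interpret H: comm_monoid H
    using H by (simp add: idem_comm_monoid_def)
  obtain KH KA where
    KH: "\<forall>c\<in>carrier (Half C). KH c \<noteq> {} \<and> KH c \<subseteq> carrier H" and
    KA: "\<forall>u\<in>Arrows C. KA u \<noteq> {} \<and> KA u \<subseteq> carrier H" and
    KHA: "\<forall>x y. \<forall>c\<in>HArr C x. \<forall>u\<in>Arr C x y. \<forall>k\<in>KH c. \<forall>l\<in>KA u. k \<otimes>\<^bsub>H\<^esub> l \<in> KH (act C c u)" and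
    KHH: "\<forall>c\<in>carrier (Half C). \<forall>d\<in>carrier (Half C). \<forall>k\<in>KH c. \<forall>l\<in>KH d.
        k \<otimes>\<^bsub>H\<^esub> l \<in> KH (c \<otimes>\<^bsub>Half C\<^esub> d)" and
    disj: "\<forall>y. \<forall>c\<in>HArr C y. \<forall>c'\<in>HArr C y. c \<noteq> c' \<longrightarrow> KH c \<inter> KH c' = {}"
    using div unfolding divides_def flat_alg_def forest_alg.simps
    by (elim exE conjE) (rule that; assumption)
  define k where "k = case_sum (\<lambda>c. SOME h. h \<in> KH c) (\<lambda>u. SOME h. h \<in> KA u)"
  have kH: "k (Inl c) \<in> KH c" if "c \<in> carrier (Half C)" for c
    using KH that by (simp add: k_def some_in_eq)
  have kA: "k (Inr u) \<in> KA u" if "u \<in> Arrows C" for u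
    using KA that by (simp add: k_def some_in_eq)
  define L where "L = Inl ` carrier (Half C) \<union> Inr ` Arrows C"
  have kL: "k \<in> L \<rightarrow> carrier H"
    using kH kA KH KA unfolding L_def by blast
  have kS: "k \<in> S \<rightarrow> carrier H" if "S \<subseteq> L" for S
    using kL that by blast
  \<comment> \<open>The product runs over a set, so each label counts once. Idempotence makes \<phi>
    turn unions into products even when the two sets overlap.\<close>
  define \<phi> where "\<phi> = finprod H k"
  have \<phi>Un: "\<phi> (S \<union> T) = \<phi> S \<otimes>\<^bsub>H\<^esub> \<phi> T" if "finite S" "S \<subseteq> L" "finite T" "T \<subseteq> L" for S T
    unfolding \<phi>_def using that by (intro finprod_Un_idem H kS) auto
  have \<phi>1: "\<phi> {s} = k s" if "s \<in> L" for s
    unfolding \<phi>_def using kS[of "{s}"] that by (simp add: H.finprod_insert)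
  have supp_L: "supp D \<subseteq> L" if "is_forest_diagram C D" for D
    using supp_is_forest_diagram[OF that] by (simp add: L_def)
  \<comment> \<open>The empty diagram must be left out: its product is the identity of
    \<open>H\<close>, and division does not put this element into the covering set of the identity
    half-arrow.\<close>
  have forest: "\<phi> (supp D) \<in> KH (val C D)"
    if "D \<noteq> {#}" "is_forest_diagram C D" "\<And>t. t \<in># D \<Longrightarrow> \<phi> (supp {#t#}) \<in> KH (tree_val C t)" for D
    using that
  proof (induction D)
    case (add t D)
    have t: "is_tree C t" and D: "is_forest_diagram C D"
      using add.prems by auto
    show ?case
    proof (cases "D = {#}")
      case True
      then show ?thesis
        using add.prems t by (simp add: val_singleton)
    next
      case False
      have "\<phi> (supp (add_mset t D)) = \<phi> (supp {#t#}) \<otimes>\<^bsub>H\<^esub> \<phi> (supp D)"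
        using t D supp_L[of "{#t#}"] supp_L[of D]
        by (subst supp_add_mset) (simp add: \<phi>Un finite_supp)
      moreover have "\<dots> \<in> KH (tree_val C t \<otimes>\<^bsub>Half C\<^esub> val C D)"
        using KHH add False t D tree_val_closed val_closed by simp
      ultimately show ?thesis
        using t D by (simp add: val_add_mset)
    qed
  qed simp
  have tree: "\<phi> (supp {#t#}) \<in> KH (tree_val C t)" if "is_tree C t" for t
    using that
  proof induction
    case (Leaf c)
    then show ?case by (simp add: \<phi>1 L_def kH)
  next
    case (Node M u)
    have M: "is_forest_diagram C M"
      using Node by (simp add: is_forest_diagram_def)
    have u: "Inr u \<in> L"
      using Node.hyps by (simp add: L_def)
    \<comment> \<open>The label \<open>u\<close> may already occur below the node; the union rule
      covers this case as well.\<close>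
    have "\<phi> (supp M \<union> {Inr u}) = \<phi> (supp M) \<otimes>\<^bsub>H\<^esub> k (Inr u)"
      using \<phi>Un[of "supp M" "{Inr u}"] \<phi>1[OF u] u supp_L[OF M] by (simp add: finite_supp)
    moreover have "\<dots> \<in> KH (act C (val C M) u)"
    proof -
      have "\<phi> (supp M) \<in> KH (val C M)"
        using forest[OF _ M] Node by simp
      moreover have "val C M \<in> HArr C (src C u)" "u \<in> Arr C (src C u) (tgt C u)"
        using val_HArr[OF M] Node.hyps by (auto simp: Arr_def)
      ultimately show ?thesis
        using KHA kA Node.hyps by blast
    qed
    ultimately show ?case by (simp add: val_def)
  qed
  have cover: "\<phi> (supp D) \<in> KH (val C D)" if "D \<noteq> {#}" "is_forest_diagram C D" for D
    using that tree by (intro forest) (auto simp: is_forest_diagram_def)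
  show ?thesis
  proof (cases "D1 = {#} \<or> D2 = {#}")
    case True
    \<comment> \<open>Every tree contributes its root label, so only the empty diagram has empty
      support. Hence if one of the two diagrams is empty, so is the other.\<close>
    have "D = {#}" if "supp D = {}" for D :: "('h, 'a) forest"
    proof (cases D)
      case (add t E)
      then show ?thesis
        using that by (cases t) (auto simp: supp_def)
    qed
    then show ?thesis
      using True supp by (metis supp_empty)
  next
    case False
    then have "\<phi> (supp D1) \<in> KH (val C D1) \<inter> KH (val C D2)"
      using cover[of D1] cover[of D2] D supp by simp
    then show ?thesis
      using disj val_HArr[OF D(1)] val_HArr[OF D(2)] roots by fastforce
  qed
qed

section \<open>From equality of values to a division\<close>

text \<open>The hypothesis enters only through disjointness: directly for half-arrows, and for
  arrows after letting them act on a leaf. The closure conditions come from constructions on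
  diagrams.\<close>

lemma globally_idem_comm_if_val_eq:
  assumes val_eq: "\<And>D1 D2. \<lbrakk>is_forest_diagram C D1; is_forest_diagram C D2;
    supp D1 = supp D2; rootsum C D1 = rootsum C D2\<rbrakk> \<Longrightarrow> val C D1 = val C D2"
  shows "globally_idem_comm C"
proof -
  define F :: "('h + 'a) set monoid" where
    "F = \<lparr>carrier = {S. finite S}, monoid.mult = (\<union>), one = {}\<rparr>"
  have F: "idem_comm_monoid F"
    unfolding idem_comm_monoid_def F_def by (auto intro!: comm_monoidI)
  \<comment> \<open>The empty diagram is excluded because a node must have a child.\<close>
  define ok where "ok D \<longleftrightarrow> D \<noteq> {#} \<and> is_forest_diagram C D" for D
  define KH where "KH c = {supp D |D. ok D \<and> val C D = c}" for c
  \<comment> \<open>Defining covers of arrows by their effect on diagrams avoids diagrams with a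
    hole. The restriction on \<open>rootsum C D\<close> makes the action of \<open>u\<close> on
    \<open>val C D\<close> meaningful, and \<open>finite S\<close> keeps the cover inside the
    carrier of \<open>F\<close>.\<close>
  define KA where "KA u = {S. finite S \<and> (\<forall>D. ok D \<and> rootsum C D = src C u \<longrightarrow>
    (\<exists>E. ok E \<and> supp E = supp D \<union> S \<and> val C E = act C (val C D) u))}" for u
  have root: "rootsum C D = hend C (val C D)" if "ok D" for D
    using that hend_val by (simp add: ok_def)
  have valH: "val C D \<in> HArr C (rootsum C D)" if "ok D" for D
    using that val_HArr by (simp add: ok_def)
  \<comment> \<open>Recording the root sum \<open>y\<close> of the new diagram allows an arrow
    starting at \<open>y\<close> to be applied to it next.\<close>
  have step: "\<exists>E. ok E \<and> supp E = supp D \<union> S \<and> val C E = act C (val C D) u \<and> rootsum C E = y"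
    if D: "ok D" "rootsum C D = x" and S: "S \<in> KA u" and u: "u \<in> Arr C x y" for D S u x y
  proof -
    have "rootsum C D = src C u"
      using D u by (simp add: Arr_def)
    then obtain E where E: "ok E" "supp E = supp D \<union> S" "val C E = act C (val C D) u"
      using D(1) S unfolding KA_def by blast
    have "act C (val C D) u \<in> HArr C y"
      using D u valH[of D] act_closed by simp
    then show ?thesis
      using E root[of E] by (auto simp: HArr_def)
  qed
  have leaf: "ok {#Leaf c#}" "val C {#Leaf c#} = c" if "c \<in> carrier (Half C)" for c
    using that by (simp_all add: ok_def is_tree.Leaf val_singleton)
  have union: "ok (D + E)" "val C (D + E) = val C D \<otimes>\<^bsub>Half C\<^esub> val C E" if "ok D" "ok E" for D E
    using that by (auto simp: ok_def val_union)
  have finKH: "finite S" if "S \<in> KH c" for S c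
    using that by (auto simp: KH_def finite_supp)
  have finKA: "finite S" if "S \<in> KA u" for S u
    using that by (simp add: KA_def)
  have "divides C (flat_alg F)"
    unfolding divides_def flat_alg_def forest_alg.simps
  proof (rule exI[of _ KH], rule exI[of _ KA], intro conjI)
    show "\<forall>c\<in>carrier (Half C). KH c \<noteq> {} \<and> KH c \<subseteq> carrier F"
    proof
      fix c
      assume "c \<in> carrier (Half C)"
      from leaf[OF this] have "supp {#Leaf c#} \<in> KH c"
        unfolding KH_def by blast
      then show "KH c \<noteq> {} \<and> KH c \<subseteq> carrier F"
        using finKH by (auto simp: F_def)
    qed
    show "\<forall>u\<in>Arrows C. KA u \<noteq> {} \<and> KA u \<subseteq> carrier F"
    proof
      fix u
      assume u: "u \<in> Arrows C"
      \<comment> \<open>Placing the roots of \<open>D\<close> under a new node labeled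
        \<open>u\<close> adds exactly this label and applies \<open>u\<close> to the value.\<close>
      have "{Inr u} \<in> KA u"
        unfolding KA_def
      proof (intro CollectI conjI allI impI)
        fix D
        assume D: "ok D \<and> rootsum C D = src C u"
        then have t: "is_tree C (Node u D)"
          using u by (auto simp: ok_def is_forest_diagram_def intro!: is_tree.Node)
        then have "ok {#Node u D#}"
          by (simp add: ok_def)
        moreover have "val C {#Node u D#} = act C (val C D) u"
          using val_singleton[OF t] by (simp add: val_def)
        ultimately show "\<exists>E. ok E \<and> supp E = supp D \<union> {Inr u} \<and> val C E = act C (val C D) u"
          by (intro exI[of _ "{#Node u D#}"]) simp
      qed simp
      then show "KA u \<noteq> {} \<and> KA u \<subseteq> carrier F"
        using finKA by (auto simp: F_def)
    qed
    show "\<forall>x y z. \<forall>u\<in>Arr C x y. \<forall>v\<in>Arr C y z. \<forall>k\<in>KA u. \<forall>l\<in>KA v.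
        k \<otimes>\<^bsub>F\<^esub> l \<in> KA (arr_comp C u v)"
    proof (intro allI ballI)
      fix x y z u v k l
      assume u: "u \<in> Arr C x y" and v: "v \<in> Arr C y z" and k: "k \<in> KA u" and l: "l \<in> KA v"
      \<comment> \<open>Two successive extensions suffice: first by \<open>k\<close> for
        \<open>u\<close>, then by \<open>l\<close> for \<open>v\<close>; \<open>act_comp\<close>
        merges the two actions.\<close>
      have "\<exists>E. ok E \<and> supp E = supp D \<union> (k \<union> l) \<and> val C E = act C (val C D) (arr_comp C u v)"
        if D: "ok D" "rootsum C D = src C (arr_comp C u v)" for D
      proof -
        have Dx: "rootsum C D = x"
          using D(2) comp_closed[OF u v] by (simp add: Arr_def)
        obtain E where E: "ok E" "supp E = supp D \<union> k" "val C E = act C (val C D) u" "rootsum C E = y"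
          using step[OF D(1) Dx k u] by blast
        obtain G where G: "ok G" "supp G = supp E \<union> l" "val C G = act C (val C E) v"
          using step[OF E(1) E(4) l v] by blast
        have "val C G = act C (val C D) (arr_comp C u v)"
          using G(3) E(3) act_comp[of "val C D" x u y v z] valH[OF D(1)] Dx u v by simp
        then show ?thesis
          using G E by (intro exI[of _ G]) auto
      qed
      moreover have "finite (k \<union> l)"
        using finKA[OF k] finKA[OF l] by simp
      ultimately show "k \<otimes>\<^bsub>F\<^esub> l \<in> KA (arr_comp C u v)"
        unfolding F_def KA_def by simp
    qed
    show "\<forall>x y. \<forall>c\<in>HArr C x. \<forall>u\<in>Arr C x y. \<forall>k\<in>KH c. \<forall>l\<in>KA u.
        (\<lambda>h v. h \<otimes>\<^bsub>F\<^esub> v) k l \<in> KH (act C c u)"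
    proof (intro allI ballI)
      fix x y c u k l
      assume c: "c \<in> HArr C x" and u: "u \<in> Arr C x y" and k: "k \<in> KH c" and l: "l \<in> KA u"
      obtain D where D: "ok D" "k = supp D" "val C D = c"
        using k by (auto simp: KH_def)
      then have "rootsum C D = x"
        using root c by (simp add: HArr_def)
      from step[OF D(1) this l u] show "k \<otimes>\<^bsub>F\<^esub> l \<in> KH (act C c u)"
        using D by (auto simp: F_def KH_def)
    qed
    show "\<forall>c\<in>carrier (Half C). \<forall>d\<in>carrier (Half C). \<forall>k\<in>KH c. \<forall>l\<in>KH d.
        k \<otimes>\<^bsub>F\<^esub> l \<in> KH (c \<otimes>\<^bsub>Half C\<^esub> d)"
    proof (intro ballI)
      fix c d k l
      assume "k \<in> KH c" and "l \<in> KH d"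
      then obtain D E where "ok D" "k = supp D" "val C D = c" "ok E" "l = supp E" "val C E = d"
        by (auto simp: KH_def)
      then show "k \<otimes>\<^bsub>F\<^esub> l \<in> KH (c \<otimes>\<^bsub>Half C\<^esub> d)"
        unfolding KH_def F_def by (intro CollectI exI[of _ "D + E"]) (simp add: union)
    qed
    show "\<forall>u\<in>Arrows C. \<forall>c\<in>carrier (Half C). \<forall>k\<in>KA u. \<forall>l\<in>KH c.
        (\<lambda>v h. v \<otimes>\<^bsub>F\<^esub> h) k l \<in> KA (ins C u c)"
    proof (intro ballI)
      fix u c k l
      assume "u \<in> Arrows C" and "c \<in> carrier (Half C)" and k: "k \<in> KA u" and l: "l \<in> KH c"
      then have u: "u \<in> Arr C (src C u) (tgt C u)" and c: "c \<in> HArr C (hend C c)"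
        by (auto simp: Arr_def HArr_def)
      obtain E where E: "ok E" "l = supp E" "val C E = c"
        using l by (auto simp: KH_def)
      \<comment> \<open>The witness extends \<open>D\<close> by \<open>k\<close> for
        \<open>u\<close> and sets the diagram \<open>E\<close> of value \<open>c\<close> beside the
        result; \<open>act_ins\<close> identifies the sum of their values.\<close>
      have "\<exists>G. ok G \<and> supp G = supp D \<union> (k \<union> l) \<and> val C G = act C (val C D) (ins C u c)"
        if D: "ok D" "rootsum C D = src C (ins C u c)" for D
      proof -
        have Dx: "rootsum C D = src C u"
          using D(2) ins_closed[OF u c] by (simp add: Arr_def)
        obtain G where G: "ok G" "supp G = supp D \<union> k" "val C G = act C (val C D) u"
          using step[OF D(1) Dx k u] by blast
        have "val C D \<in> HArr C (src C u)"
          using valH[OF D(1)] Dx by simp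
        then have "val C (G + E) = act C (val C D) (ins C u c)"
          using act_ins[OF _ u c] union(2)[OF G(1) E(1)] G(3) E(3) by simp
        then show ?thesis
          using G E union(1) by (intro exI[of _ "G + E"]) auto
      qed
      moreover have "finite (k \<union> l)"
        using finKA[OF k] finKH[OF l] by simp
      ultimately show "k \<otimes>\<^bsub>F\<^esub> l \<in> KA (ins C u c)"
        unfolding F_def KA_def by simp
    qed
    show "\<forall>x y. \<forall>u\<in>Arr C x y. \<forall>u'\<in>Arr C x y. u \<noteq> u' \<longrightarrow> KA u \<inter> KA u' = {}"
    proof (intro allI ballI impI, rule ccontr)
      fix x y u u'
      assume u: "u \<in> Arr C x y" and u': "u' \<in> Arr C x y" and "u \<noteq> u'" and "KA u \<inter> KA u' \<noteq> {}"
      then obtain S where S: "S \<in> KA u" "S \<in> KA u'"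
        by blast
      \<comment> \<open>Every half-arrow \<open>c\<close> to \<open>x\<close> is the value of a
        single leaf. Extending this leaf by the same \<open>S\<close> for \<open>u\<close> and for
        \<open>u'\<close> gives diagrams with equal support and root sum \<open>y\<close>, so
        \<open>val_eq\<close> applies and faithfulness can follow.\<close>
      have "act C c u = act C c u'" if c: "c \<in> HArr C x" for c
      proof -
        have l: "ok {#Leaf c#}" "val C {#Leaf c#} = c" "rootsum C {#Leaf c#} = x"
          using leaf[of c] c root[of "{#Leaf c#}"] by (auto simp: HArr_def)
        obtain E where E: "ok E" "supp E = supp {#Leaf c#} \<union> S" "val C E = act C c u" "rootsum C E = y"
          using step[OF l(1,3) S(1) u] unfolding l(2) by blast
        obtain E' where E': "ok E'" "supp E' = supp {#Leaf c#} \<union> S" "val C E' = act C c u'" "rootsum C E' = y"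
          using step[OF l(1,3) S(2) u'] unfolding l(2) by blast
        show ?thesis
          using val_eq[of E E'] E E' by (simp add: ok_def)
      qed
      then show False
        using act_faithful[OF u u'] \<open>u \<noteq> u'\<close> by blast
    qed
    show "\<forall>y. \<forall>c\<in>HArr C y. \<forall>c'\<in>HArr C y. c \<noteq> c' \<longrightarrow> KH c \<inter> KH c' = {}"
    proof (intro allI ballI impI, rule ccontr)
      fix y c c'
      assume c: "c \<in> HArr C y" "c' \<in> HArr C y" "c \<noteq> c'" and "KH c \<inter> KH c' \<noteq> {}"
      then obtain D E where "ok D" "val C D = c" "ok E" "val C E = c'" "supp D = supp E"
        by (auto simp: KH_def)
      \<comment> \<open>Both root sums are the common end \<open>y\<close> of the two
        values.\<close>
      moreover from this have "rootsum C D = rootsum C E"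
        using root c by (simp add: HArr_def)
      ultimately show False
        using val_eq[of D E] c(3) by (simp add: ok_def)
    qed
  qed
  with F show ?thesis
    unfolding globally_idem_comm_def by blast
qed

end

theorem theorem3:
  fixes C :: "('o, 'h, 'a) forest_cat"
  assumes "forest_category C"
  shows "globally_idem_comm C \<longleftrightarrow>
    (\<forall>D1 D2. is_forest_diagram C D1 \<and> is_forest_diagram C D2 \<and>
       supp D1 = supp D2 \<and> rootsum C D1 = rootsum C D2 \<longrightarrow> val C D1 = val C D2)"
proof -
  interpret forest_category C by fact
  show ?thesis
    using val_eq_if_globally_idem_comm globally_idem_comm_if_val_eq by blast
qed

end
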